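(* Let $p\ge 5$ be a prime and let $n:=2^{p-1}$. Then $2^p-1$ is prime if and only if $$2n-1\ \Big|\ \sum_{\substack{0\le k\le \lfloor n/2\rfloor\\ k\text{ even}}}(-1)^{\lfloor k/2\rfloor}\,\frac{\prod_{\lambda=0}^{\lfloor k/2\rfloor-1}\big(n^2-(4\lambda)^2\big)}{k!}.$$
   Context: The empty product $\prod_{\lambda=0}^{-1}$ equals $1$. Each summand is in fact an integer, and divisibility is divisibility of integers. *)

theory Defs
  imports Complex_Main "HOL-Computational_Algebra.Primes"
begin

end

theory Submission
  imports Defs "HOL-Number_Theory.Number_Theory"
begin

text \<open>
  The sum is a Chebyshev polynomial in disguise, and its divisibility by \<open>2 ^ p - 1\<close> is the
  Lucas--Lehmer test.

  Put \<open>n = 4 N\<close>, so that \<open>N = 2 ^ (p - 3)\<close>. With \<open>k = 2 j\<close> the summand becomes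
  \<open>(-16) ^ j / (2 j)!\<close> times the central factorial product of the \<open>N\<^sup>2 - l\<^sup>2\<close> for \<open>l < j\<close>.
  This is the classical expansion of \<open>cos (2 N \<theta>)\<close> in powers of \<open>(sin \<theta>)\<^sup>2\<close>, evaluated at
  \<open>(sin \<theta>)\<^sup>2 = 4\<close>, where \<open>cos (2 \<theta>) = -7\<close>; hence the sum is the Chebyshev value \<open>T N (-7)\<close>.
  The proof of the expansion uses no trigonometry: the second difference in \<open>x\<close> of a central
  factorial product is a multiple of the preceding one (\<open>central_prod_second_difference\<close>), so the
  sum satisfies the Chebyshev recurrence (\<open>cheb_sum_rec\<close>). In particular it is an integer.

  The roots of \<open>X\<^sup>2 + 14 X + 1\<close> are \<open>- \<omega>\<^sup>2\<close> and \<open>- \<omega>'\<^sup>2\<close>, where \<open>\<omega> = 2 + \<surd>3\<close> and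
  \<open>\<omega>' = 2 - \<surd>3\<close>. As \<open>N\<close> is even, twice the sum equals
  \<open>\<omega> ^ 2 ^ (p - 2) + \<omega>' ^ 2 ^ (p - 2)\<close>, the Lucas--Lehmer number, and
  the factor two is harmless modulo the odd number \<open>2 ^ p - 1\<close>.

  What remains is the Lucas--Lehmer test itself (\<open>lucas_lehmer\<close>). Multiplication by a power of the
  unit \<open>\<omega>\<close> turns its condition into \<open>\<omega> ^ 2 ^ (p - 1) \<equiv> -1\<close> modulo \<open>M = 2 ^ p - 1\<close>. If this
  holds, then \<open>\<omega>\<close> has exact order \<open>2 ^ p\<close> modulo every divisor \<open>d > 1\<close> of \<open>M\<close>; a composite \<open>M\<close>
  has such a divisor with \<open>d\<^sup>2 \<le> M\<close>, which leaves too few residue classes. Conversely, let \<open>M\<close> be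
  prime. Then three is a quadratic nonresidue, so raising to the power \<open>M\<close> acts as conjugation,
  and \<open>(1 + \<surd>3)\<^sup>2 = 2 \<omega>\<close> together with the norm \<open>-2\<close> of \<open>1 + \<surd>3\<close> gives the congruence.
\<close>

section \<open>The ring of integers with a square root of three adjoined\<close>

text \<open>
  Pairs of integers are used instead of real numbers: residue classes modulo an integer can then
  be read off from the two components, and congruence is divisibility in the ring.
\<close>
datatype zsqrt3 = ZS (rat_part: int) (sqrt_part: int)

instantiation zsqrt3 :: comm_ring_1
begin

definition "0 = ZS 0 0"
definition "1 = ZS 1 0"
definition "x + y = ZS (rat_part x + rat_part y) (sqrt_part x + sqrt_part y)"
definition "x - y = ZS (rat_part x - rat_part y) (sqrt_part x - sqrt_part y)"
definition "- x = ZS (- rat_part x) (- sqrt_part x)"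
definition "x * y = ZS (rat_part x * rat_part y + 3 * sqrt_part x * sqrt_part y)
  (rat_part x * sqrt_part y + sqrt_part x * rat_part y)"

instance
  by standard
    (simp_all add: zero_zsqrt3_def one_zsqrt3_def plus_zsqrt3_def minus_zsqrt3_def
      uminus_zsqrt3_def times_zsqrt3_def algebra_simps)

end

lemma of_nat_zsqrt3: "of_nat n = ZS (int n) 0"
  by (induction n) (simp_all add: zero_zsqrt3_def one_zsqrt3_def plus_zsqrt3_def)

lemma of_int_zsqrt3: "of_int m = ZS m 0"
  by (cases m rule: int_cases2) (simp_all add: of_nat_zsqrt3 uminus_zsqrt3_def)

lemma numeral_zsqrt3: "numeral w = ZS (numeral w) 0"
  using of_int_zsqrt3[of "numeral w"] by simp

lemmas zsqrt3_simps = zero_zsqrt3_def one_zsqrt3_def plus_zsqrt3_def minus_zsqrt3_def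
  uminus_zsqrt3_def times_zsqrt3_def numeral_zsqrt3

lemma of_int_dvd_ZS_iff: "of_int m dvd ZS a b \<longleftrightarrow> m dvd a \<and> m dvd b"
proof
  assume "of_int m dvd ZS a b"
  then obtain x where "ZS a b = of_int m * x" by (rule dvdE)
  then show "m dvd a \<and> m dvd b"
    by (simp add: of_int_zsqrt3 times_zsqrt3_def)
next
  assume "m dvd a \<and> m dvd b"
  then obtain c d where "a = m * c" "b = m * d" by (auto elim!: dvdE)
  then have "ZS a b = of_int m * ZS c d"
    by (simp add: of_int_zsqrt3 times_zsqrt3_def)
  then show "of_int m dvd ZS a b" by simp
qed

lemma of_int_dvd_of_int_zsqrt3: "of_int m dvd (of_int k :: zsqrt3) \<longleftrightarrow> m dvd k"
  by (simp add: of_int_zsqrt3[of k] of_int_dvd_ZS_iff)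

text \<open>Allows the factors of two that arise from conjugate sums and from \<open>(1 + \<surd>3)\<^sup>2\<close> to be dropped.\<close>
lemma odd_dvd_two_times_zsqrt3:
  fixes x :: zsqrt3
  assumes "odd m"
  shows "of_int m dvd 2 * x \<longleftrightarrow> of_int m dvd x"
proof -
  have "coprime m 2" using assms by simp
  then show ?thesis
    by (cases x) (simp add: zsqrt3_simps of_int_dvd_ZS_iff coprime_dvd_mult_right_iff)
qed

abbreviation sqrt3 :: zsqrt3 where "sqrt3 \<equiv> ZS 0 1"
text \<open>The fundamental unit \<open>\<omega> = 2 + \<surd>3\<close> of the ring; its conjugate is also its inverse.\<close>
abbreviation unit3 :: zsqrt3 where "unit3 \<equiv> ZS 2 1"
abbreviation unit3_conj :: zsqrt3 where "unit3_conj \<equiv> ZS 2 (-1)"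

lemma unit3_mult_conj: "unit3 * unit3_conj = 1"
  by (simp add: zsqrt3_simps)

lemma unit3_power_mult_conj: "unit3 ^ k * unit3_conj ^ k = 1"
  by (simp add: power_mult_distrib[symmetric] unit3_mult_conj)

lemma power_cong_dvd:
  fixes x y :: "'a::comm_ring_1"
  assumes "m dvd x - y"
  shows "m dvd x ^ k - y ^ k"
  using assms by (metis dvd_mult2 power_diff_sumr2)

text \<open>
  The inner binomial coefficients of a prime row are divisible by that prime. The statement uses
  divisibility because the rings of interest have characteristic zero.
\<close>
lemma frobenius_dvd:
  fixes x y :: "'a::comm_ring_1"
  assumes "prime q"
  shows "of_nat q dvd (x + y) ^ q - (x ^ q + y ^ q)"
proof -
  have q: "q > 0" using assms by (simp add: prime_gt_0_nat)
  let ?f = "\<lambda>k. of_nat (q choose k) * x ^ k * y ^ (q - k)"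
  have "{..q} = insert 0 (insert q {0<..<q})" using q by auto
  then have "(x + y) ^ q = ?f 0 + (?f q + sum ?f {0<..<q})"
    using q by (simp add: binomial_ring)
  then have "(x + y) ^ q - (x ^ q + y ^ q) = sum ?f {0<..<q}"
    by simp
  moreover have "of_nat q dvd ?f k" if "k \<in> {0<..<q}" for k
  proof -
    have "q dvd q choose k"
      using assms that by (intro dvd_choose_prime) auto
    then have "of_nat q dvd (of_nat (q choose k) :: 'a)"
      by (auto elim!: dvdE)
    then show ?thesis by (simp add: dvd_mult2)
  qed
  ultimately show ?thesis by (simp only:) (rule dvd_sum)
qed

section \<open>The Lucas--Lehmer criterion\<close>

text \<open>
  By Euler's criterion this says that three is a quadratic nonresidue. Since \<open>p\<close> is odd,
  \<open>q \<equiv> 1\<close> modulo \<open>3\<close>, so \<open>q\<close> is a residue modulo \<open>3\<close>; since \<open>q \<equiv> 3\<close> modulo \<open>4\<close>, reciprocity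
  flips the sign.
\<close>
lemma three_power_mersenne:
  fixes p q :: nat
  assumes "odd p" "p \<ge> 3" "q = 2 ^ p - 1" "prime q"
  shows "int q dvd 3 ^ ((q - 1) div 2) + 1"
proof -
  \<comment> \<open>\<open>2 ^ p = 2 * 4 ^ m\<close> is congruent to \<open>2\<close> modulo \<open>3\<close>.\<close>
  obtain m where m: "p = 2 * m + 1" using assms(1) by (rule oddE)
  have q8: "q \<ge> 7"
    using power_increasing[of 3 p "2::nat"] assms(2,3) by simp
  have "[4 ^ m = 1 ^ m] (mod (3::nat))"
    by (intro cong_pow) (simp add: cong_def)
  then have "2 ^ p mod 3 = (2::nat)"
    unfolding m by (simp add: power_mult cong_def) presburger
  moreover have "2 ^ p = q + 1" using assms(3) by simp
  ultimately have "(q + 1) mod 3 = 2" by simp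
  then have "q mod 3 = 1" by presburger
  then have "int (q mod 3) = 1" by simp
  then have q1: "[int q = 1\<^sup>2] (mod 3)"
    by (simp add: cong_def zmod_int)
  have L1: "Legendre (int q) 3 = 1"
  proof -
    have "QuadRes 3 (int q)"
      using q1 unfolding QuadRes_def by (blast intro: cong_sym)
    moreover have "\<not> [int q = 0] (mod 3)"
      using q1 by (simp add: cong_def)
    ultimately show ?thesis by (simp add: Legendre_def)
  qed
  have h: "(q - 1) div 2 = 2 ^ (p - 1) - 1"
    using assms(2,3) by (cases p) auto
  have "odd ((q - 1) div 2)"
    unfolding h using assms(2) by (simp add: even_diff_nat)
  moreover have "Legendre (int 3) (int q) * Legendre (int q) (int 3)
      = (-1) ^ ((3 - 1) div 2 * ((q - 1) div 2))"
    using q8 assms(4) by (intro Quadratic_Reciprocity) auto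
  ultimately have "Legendre 3 (int q) = -1"
    using L1 by simp
  moreover have "[Legendre 3 (int q) = 3 ^ ((q - 1) div 2)] (mod int q)"
    using euler_criterion[of q 3] q8 assms(4) by simp
  ultimately have "[3 ^ ((q - 1) div 2) = -1] (mod int q)"
    by (simp add: cong_sym)
  then show ?thesis by (simp add: cong_iff_dvd_diff)
qed

text \<open>
  The order of two modulo \<open>2 ^ p - 1\<close> divides \<open>p\<close>, and Fermat's theorem for \<open>p\<close> itself says that
  \<open>p\<close> divides the exponent. When \<open>q = 2 ^ p - 1\<close> is prime, the exponent is \<open>(q - 1) / 2\<close>, so
  this is Euler's criterion for the residue two.
\<close>
lemma two_power_mersenne:
  assumes "prime p" "odd p"
  shows "(2 ^ p - 1 :: int) dvd 2 ^ (2 ^ (p - 1) - 1) - 1"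
proof -
  have "\<not> p dvd 2"
    using assms primes_dvd_imp_eq two_is_prime_nat by blast
  then have "[2 ^ (p - 1) = 1] (mod p)"
    by (rule fermat_theorem[OF assms(1)])
  then have "p dvd 2 ^ (p - 1) - 1"
    by (rule cong_to_1_nat)
  then obtain k where "2 ^ (p - 1) - 1 = p * k" by (rule dvdE)
  then show ?thesis
    using power_cong_dvd[of "2 ^ p - 1" "2 ^ p" "1::int" k] by (simp add: power_mult)
qed

text \<open>
  Compute \<open>(1 + \<surd>3) ^ (q + 1)\<close> modulo \<open>q = 2 ^ p - 1\<close> in two ways. The Frobenius map sends
  \<open>1 + \<surd>3\<close> to its conjugate, so the power is the norm \<open>-2\<close>. On the other hand
  \<open>(1 + \<surd>3)\<^sup>2 = 2 \<omega>\<close>, so with \<open>n = (q + 1) / 2\<close> the power is \<open>2 ^ n * \<omega> ^ n\<close>, which is congruent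
  to \<open>2 * \<omega> ^ n\<close>.
\<close>
lemma lucas_lehmer_necessary:
  fixes p :: nat
  assumes "prime p" "odd p" "prime (2 ^ p - 1 :: nat)"
  shows "of_int (2 ^ p - 1) dvd unit3 ^ 2 ^ (p - 1) + 1"
proof -
  define q :: nat where "q = 2 ^ p - 1"
  define n :: nat where "n = 2 ^ (p - 1)"
  define M :: zsqrt3 where "M = of_int (int q)"
  have p3: "p \<ge> 3"
    using assms(1,2) prime_ge_2_nat[of p] by (cases "p = 2") auto
  have iq: "int q = 2 ^ p - 1" by (simp add: q_def of_nat_diff)
  have pn: "(2::nat) ^ p = 2 * n" using p3 by (cases p) (auto simp: n_def)
  have n1: "n \<ge> 1" by (simp add: n_def)
  have qn: "q = 2 * (n - 1) + 1" using pn n1 by (simp add: q_def)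
  have sq: "sqrt3 ^ q = sqrt3 * of_int (3 ^ (n - 1))"
  proof -
    have "sqrt3 ^ 2 = 3" by (simp add: power2_eq_square zsqrt3_simps)
    then show ?thesis unfolding qn by (simp add: power_add power_mult)
  qed
  have "int q dvd 3 ^ (n - 1) + 1"
  proof -
    have "(q - 1) div 2 = n - 1" using qn by simp
    moreover have "prime q" using assms(3) by (simp only: q_def)
    ultimately show ?thesis
      using three_power_mersenne[OF assms(2) p3 q_def] by simp
  qed
  then have "M dvd of_int (3 ^ (n - 1) + 1)"
    unfolding M_def of_int_dvd_of_int_zsqrt3 .
  then have "M dvd sqrt3 * of_int (3 ^ (n - 1) + 1)" by (rule dvd_mult)
  then have A: "M dvd sqrt3 ^ q + sqrt3" by (simp add: sq algebra_simps)
  have "M dvd (1 + sqrt3) ^ q - (1 ^ q + sqrt3 ^ q)"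
    using frobenius_dvd[of q 1 sqrt3] assms(3) by (simp add: q_def M_def)
  from dvd_add[OF this A] have "M dvd (1 + sqrt3) ^ q - (1 - sqrt3)"
    by (simp add: algebra_simps)
  then have "M dvd (1 + sqrt3) * ((1 + sqrt3) ^ q - (1 - sqrt3))" by (rule dvd_mult)
  moreover have norm: "(1 + sqrt3) * (1 - sqrt3) = - 2" by (simp add: zsqrt3_simps)
  have "(1 + sqrt3) * ((1 + sqrt3) ^ q - (1 - sqrt3)) = (1 + sqrt3) ^ (q + 1) + 2"
    by (subst right_diff_distrib) (simp only: norm, simp)
  ultimately have B: "M dvd (1 + sqrt3) ^ (q + 1) + 2"
    by (simp only:)
  have "(1 + sqrt3) ^ 2 = 2 * unit3" by (simp add: power2_eq_square zsqrt3_simps)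
  moreover have "q + 1 = 2 * n" using qn n1 by simp
  ultimately have C: "(1 + sqrt3) ^ (q + 1) = 2 ^ n * unit3 ^ n"
    by (simp add: power_mult power_mult_distrib)
  have "int q dvd 2 ^ (n - 1) - 1"
    using two_power_mersenne[OF assms(1,2)] by (simp add: iq n_def)
  then have "M dvd of_int (2 ^ (n - 1) - 1)"
    unfolding M_def of_int_dvd_of_int_zsqrt3 .
  then have "M dvd of_int (2 ^ (n - 1) - 1) * (2 * unit3 ^ n)" by (rule dvd_mult2)
  moreover have "(2::zsqrt3) ^ n = 2 * 2 ^ (n - 1)"
    using n1 by (simp flip: power_Suc)
  ultimately have "M dvd 2 ^ n * unit3 ^ n - 2 * unit3 ^ n"
    by (simp add: algebra_simps)
  from dvd_diff[OF B[unfolded C] this] have "M dvd 2 * (unit3 ^ n + 1)"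
    by (simp add: algebra_simps)
  moreover have "odd (int q)" using qn by simp
  ultimately have "M dvd unit3 ^ n + 1"
    unfolding M_def using odd_dvd_two_times_zsqrt3 by blast
  then show ?thesis by (simp only: M_def n_def iq)
qed

text \<open>
  The unit has order exactly \<open>2 ^ Suc m\<close> modulo \<open>d\<close>. If two smaller powers agreed, then
  \<open>\<omega> ^ (j - i) \<equiv> 1\<close> with \<open>j - i = 2 ^ e * c\<close>, \<open>c\<close> odd and \<open>e \<le> m\<close>. Raising this to the power
  \<open>2 ^ (m - e)\<close> gives \<open>1 \<equiv> \<omega> ^ (2 ^ m * c) \<equiv> (-1) ^ c = -1\<close>, impossible for odd \<open>d > 1\<close>.
\<close>
lemma unit3_powers_incongruent:
  fixes d :: int
  assumes "odd d" "d > 1" "of_int d dvd unit3 ^ 2 ^ m + 1"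
    and "i < j" "j < 2 ^ Suc m"
  shows "\<not> of_int d dvd unit3 ^ j - unit3 ^ i"
proof
  assume "of_int d dvd unit3 ^ j - unit3 ^ i"
  then have "of_int d dvd unit3_conj ^ i * (unit3 ^ j - unit3 ^ i)" by (rule dvd_mult)
  moreover have "unit3 ^ j = unit3 ^ i * unit3 ^ (j - i)"
    using assms(4) by (simp flip: power_add)
  then have "unit3_conj ^ i * (unit3 ^ j - unit3 ^ i)
      = (unit3 ^ i * unit3_conj ^ i) * (unit3 ^ (j - i) - 1)"
    by (simp add: algebra_simps)
  ultimately have one: "of_int d dvd unit3 ^ (j - i) - 1"
    by (simp add: unit3_power_mult_conj)
  define e where "e = multiplicity 2 (j - i)"
  have "j - i \<noteq> 0" using assms(4) by simp
  then obtain c where ec: "j - i = 2 ^ e * c" "odd c"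
    unfolding e_def by (rule multiplicity_decompose'[where p = 2]) auto
  have "2 ^ e \<le> j - i" using ec(2) unfolding ec(1) by (cases c) auto
  then have "(2::nat) ^ e < 2 ^ Suc m" using assms(5) by linarith
  then have "e \<le> m" by (simp only: power_strict_increasing_iff)
  then have "2 ^ e * 2 ^ (m - e) = (2 ^ m :: nat)"
    by (simp only: power_add[symmetric] le_add_diff_inverse)
  then have exp: "(j - i) * 2 ^ (m - e) = 2 ^ m * c"
    unfolding ec(1) by (metis mult.assoc mult.commute)
  have "of_int d dvd (unit3 ^ (j - i)) ^ 2 ^ (m - e) - 1 ^ 2 ^ (m - e)"
    by (rule power_cong_dvd[OF one])
  then have X: "of_int d dvd unit3 ^ (2 ^ m * c) - 1"
    by (simp only: exp power_mult[symmetric] power_one)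
  have "of_int d dvd (unit3 ^ 2 ^ m) ^ c - (-1) ^ c"
    by (rule power_cong_dvd) (use assms(3) in simp)
  then have Y: "of_int d dvd unit3 ^ (2 ^ m * c) + 1"
    using ec(2) by (simp add: power_mult)
  from dvd_diff[OF Y X] have "of_int d dvd (of_int 2 :: zsqrt3)" by simp
  then have "d dvd 2" unfolding of_int_dvd_of_int_zsqrt3 .
  then have "d \<le> 2" by (rule zdvd_imp_le) simp
  then show False using assms(1,2) by (cases "d = 2") auto
qed

text \<open>
  A composite \<open>M = 2 ^ p - 1\<close> has a divisor \<open>c > 1\<close> with \<open>c * c \<le> M\<close>. The ring has only \<open>c * c\<close>
  residue classes modulo \<open>c\<close>, fewer than the \<open>2 ^ p\<close> pairwise incongruent powers of the unit.
\<close>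
lemma lucas_lehmer_sufficient:
  fixes p :: nat
  assumes "p \<ge> 2" "of_int (2 ^ p - 1) dvd unit3 ^ 2 ^ (p - 1) + 1"
  shows "prime (2 ^ p - 1 :: nat)"
proof (rule ccontr)
  define M :: nat where "M = 2 ^ p - 1"
  assume "\<not> prime (2 ^ p - 1 :: nat)"
  then have "\<not> prime M" by (simp add: M_def)
  have M3: "M \<ge> 3"
    using power_increasing[of 2 p "2::nat"] assms(1) by (simp add: M_def)
  have iM: "int M = 2 ^ p - 1" by (simp add: M_def of_nat_diff)
  obtain a where a: "a dvd M" "a \<noteq> 1" "a \<noteq> M"
    using \<open>\<not> prime M\<close> M3 by (auto simp: prime_nat_iff)
  then obtain b where b: "M = a * b" by (auto elim: dvdE)
  define c where "c = min a b"
  have ab: "a > 1" "b > 1" using a b M3 by (auto intro!: Nat.gr0I simp: nat_neq_iff)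
  have c: "c > 1" "c dvd M" "c * c \<le> M"
    using ab b by (auto simp: c_def min_def mult_le_mono)
  have oddM: "odd M" using assms(1) by (simp add: M_def)
  define d where "d = int c"
  have d: "d > 1" "odd d" "d dvd int M"
    using c oddM by (auto simp: d_def dvd_trans)
  have dw: "of_int d dvd unit3 ^ 2 ^ (p - 1) + 1"
    using dvd_trans[OF _ assms(2)] d(3) of_int_dvd_of_int_zsqrt3[of d "int M"]
    by (simp add: iM)
  define residues where
    "residues i = (rat_part (unit3 ^ i) mod d, sqrt_part (unit3 ^ i) mod d)" for i :: nat
  have "inj_on residues {..<2 ^ p}"
  proof (rule linorder_inj_onI)
    fix i j :: nat
    assume ij: "i < j" "i \<in> {..<2 ^ p}" "j \<in> {..<2 ^ p}"
    have "\<not> of_int d dvd unit3 ^ j - unit3 ^ i"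
      using unit3_powers_incongruent[OF d(2,1) dw ij(1)] ij(3) assms(1) by simp
    then have "residues j \<noteq> residues i"
      by (auto simp: residues_def minus_zsqrt3_def of_int_dvd_ZS_iff mod_eq_dvd_iff)
    then show "residues i \<noteq> residues j" by (rule not_sym)
  qed auto
  moreover have "residues ` {..<2 ^ p} \<subseteq> {0..<d} \<times> {0..<d}"
    using d(1) by (auto simp: residues_def)
  ultimately have "card {..<(2::nat) ^ p} \<le> card ({0..<d} \<times> {0..<d})"
    by (intro card_inj_on_le) auto
  then have "2 ^ p \<le> c * c"
    by (simp add: d_def card_cartesian_product)
  then show False using c(3) M3 by (simp add: M_def)
qed

text \<open>
  The usual form of the test: the right-hand side is the term with index \<open>p - 2\<close> of the sequence
  that starts with \<open>4\<close> and is iterated by \<open>s \<mapsto> s\<^sup>2 - 2\<close>.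
\<close>
theorem lucas_lehmer:
  fixes p :: nat
  assumes "prime p" "odd p"
  shows "prime (2 ^ p - 1 :: nat) \<longleftrightarrow>
    of_int (2 ^ p - 1) dvd unit3 ^ 2 ^ (p - 2) + unit3_conj ^ 2 ^ (p - 2)"
proof -
  let ?e = "2 ^ (p - 2) :: nat" and ?M = "of_int (2 ^ p - 1) :: zsqrt3"
  have p2: "p \<ge> 2" using assms(1) by (rule prime_ge_2_nat)
  have e: "2 ^ (p - 1) = ?e + ?e" using p2 by (cases p; cases "p - 1") auto
  have "prime (2 ^ p - 1 :: nat) \<longleftrightarrow> ?M dvd unit3 ^ 2 ^ (p - 1) + 1"
    using lucas_lehmer_necessary lucas_lehmer_sufficient assms p2 by blast
  also have "unit3 ^ 2 ^ (p - 1) + 1 = unit3 ^ ?e * (unit3 ^ ?e + unit3_conj ^ ?e)"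
    by (simp only: e power_add distrib_left unit3_power_mult_conj)
  also have "?M dvd \<dots> \<longleftrightarrow> ?M dvd unit3 ^ ?e + unit3_conj ^ ?e"
  proof -
    let ?t = "unit3 ^ ?e + unit3_conj ^ ?e"
    have inverse: "unit3_conj ^ ?e * (unit3 ^ ?e * ?t) = ?t"
      by (simp only: mult.assoc[symmetric] mult.commute[of "unit3_conj ^ ?e" "unit3 ^ ?e"]
          unit3_power_mult_conj mult_1)
    show ?thesis
      using dvd_mult[of ?M "unit3 ^ ?e * ?t" "unit3_conj ^ ?e"] dvd_mult[of ?M ?t "unit3 ^ ?e"]
      unfolding inverse by blast
  qed
  finally show ?thesis .
qed

section \<open>Chebyshev polynomials as central factorial sums\<close>

definition central_prod :: "nat \<Rightarrow> 'a::comm_ring_1 \<Rightarrow> 'a" where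
  "central_prod j x = (\<Prod>l<j. x\<^sup>2 - (of_nat l)\<^sup>2)"

text \<open>
  Pairing the factors \<open>x - l\<close> and \<open>x + l\<close> gives \<open>2 j + 1\<close> consecutive factors centred at \<open>x\<close>, with
  \<open>x\<close> itself occurring twice. In this form a shift of \<open>x\<close> by one only changes factors at the ends.
\<close>
lemma central_prod_eq_pochhammer:
  "central_prod (Suc j) x = x * pochhammer (x - of_nat j) (2 * j + 1)"
proof (induction j)
  case 0
  then show ?case by (simp add: central_prod_def power2_eq_square)
next
  case (Suc j)
  define P where "P = pochhammer (x - of_nat j) (2 * j + 1)"
  have shift: "x - of_nat (Suc j) + 1 = x - of_nat j"
    "x - of_nat j + of_nat (2 * j + 1) = x + of_nat (Suc j)"
    and length: "2 * Suc j + 1 = Suc (Suc (2 * j + 1))" by simp_all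
  have P': "pochhammer (x - of_nat (Suc j)) (2 * Suc j + 1)
      = (x - of_nat (Suc j)) * (P * (x + of_nat (Suc j)))"
    unfolding length pochhammer_rec[of _ "Suc (2 * j + 1)"] shift(1)
      pochhammer_Suc[of _ "2 * j + 1"] shift(2) P_def ..
  have "central_prod (Suc (Suc j)) x
      = central_prod (Suc j) x * (x\<^sup>2 - (of_nat (Suc j))\<^sup>2)"
    by (simp add: central_prod_def)
  also have "\<dots> = x * P * ((x - of_nat (Suc j)) * (x + of_nat (Suc j)))"
    unfolding Suc P_def by (simp add: algebra_simps power2_eq_square)
  finally show ?case unfolding P' by (simp only: mult_ac)
qed

text \<open>
  The discrete counterpart of differentiating a monomial of degree \<open>2 j + 2\<close> twice. For \<open>j > 0\<close> all four
  products share the block \<open>F\<close> of \<open>2 j - 1\<close> consecutive factors centred at \<open>x\<close>; what is left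
  after removing it is a polynomial identity of low degree.
\<close>
lemma central_prod_second_difference:
  "central_prod (Suc j) (x + 1) + central_prod (Suc j) (x - 1)
    = 2 * central_prod (Suc j) x + of_nat (2 * Suc j * (2 * j + 1)) * central_prod j x"
proof (cases j)
  case 0
  then show ?thesis by (simp add: central_prod_def power2_eq_square algebra_simps)
next
  case (Suc i)
  define F where "F = pochhammer (x - of_nat i) (2 * i + 1)"
  define t :: 'a where "t = of_nat i"
  have low: "central_prod j x = x * F"
    by (simp only: Suc F_def central_prod_eq_pochhammer)
  have mid: "central_prod (Suc j) x = x * F * (x - t - 1) * (x + t + 1)"
    using low by (simp add: central_prod_def Suc t_def algebra_simps power2_eq_square)
  have lengths: "2 * j + 1 = Suc (Suc (2 * i + 1))" by (simp add: Suc)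
  have up: "central_prod (Suc j) (x + 1) = (x + 1) * F * (x + t + 1) * (x + t + 2)"
  proof -
    have "x + 1 - of_nat j = x - of_nat i" by (simp add: Suc)
    then have "central_prod (Suc j) (x + 1)
        = (x + 1) * pochhammer (x - of_nat i) (Suc (Suc (2 * i + 1)))"
      by (simp only: central_prod_eq_pochhammer lengths)
    also have "\<dots> = (x + 1) * (F * (x - t + of_nat (2 * i + 1)) * (x - t + of_nat (Suc (2 * i + 1))))"
      unfolding pochhammer_Suc[of _ "Suc (2 * i + 1)"] pochhammer_Suc[of _ "2 * i + 1"] F_def t_def ..
    finally show ?thesis by (simp add: t_def algebra_simps)
  qed
  have down: "central_prod (Suc j) (x - 1) = (x - 1) * F * (x - t - 1) * (x - t - 2)"
  proof -
    have shift: "x - 1 - of_nat j = x - t - 2" "x - t - 2 + 1 = x - t - 1" "x - t - 1 + 1 = x - t"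
      by (simp_all add: Suc t_def)
    have "central_prod (Suc j) (x - 1) = (x - 1) * ((x - t - 2) * ((x - t - 1) * F))"
      unfolding central_prod_eq_pochhammer lengths shift(1)
        pochhammer_rec[of _ "Suc (2 * i + 1)"] shift(2)
        pochhammer_rec[of _ "2 * i + 1"] shift(3) F_def t_def[symmetric] ..
    then show ?thesis by (simp only: mult_ac)
  qed
  have "of_nat (2 * Suc j * (2 * j + 1)) = (2 * t + 4) * (2 * t + 3)"
    by (simp add: Suc t_def algebra_simps)
  then show ?thesis
    unfolding low mid up down by (simp add: algebra_simps)
qed

text \<open>
  This is \<open>T N (1 + z / 2)\<close> for the Chebyshev polynomial of degree \<open>N\<close>. With
  \<open>z = -4 (sin \<theta>)\<^sup>2\<close> it is the expansion of \<open>cos (2 N \<theta>)\<close> in powers of \<open>sin \<theta>\<close>.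
\<close>
definition cheb_sum :: "'a::field_char_0 \<Rightarrow> nat \<Rightarrow> 'a" where
  "cheb_sum z N = (\<Sum>j\<le>N. z ^ j * central_prod j (of_nat N) / fact (2 * j))"

lemma central_prod_eq_0: "N < j \<Longrightarrow> central_prod j (of_nat N) = 0"
  by (auto simp: central_prod_def intro!: prod_zero)

text \<open>
  The terms beyond \<open>N\<close> vanish, so sums for neighbouring values of \<open>N\<close> can be compared over a
  common range.
\<close>
lemma cheb_sum_extend:
  assumes "N \<le> K"
  shows "cheb_sum z N = (\<Sum>j\<le>K. z ^ j * central_prod j (of_nat N) / fact (2 * j))"
  unfolding cheb_sum_def
  by (rule sum.mono_neutral_left) (use assms in \<open>auto simp: central_prod_eq_0\<close>)

text \<open>
  Apply the second difference termwise: the factor \<open>2 (j + 1) (2 j + 1)\<close> is exactly the quotient of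
  the factorials in two neighbouring terms, so the second difference of the sum is \<open>z\<close> times the
  sum itself.
\<close>
lemma cheb_sum_rec:
  fixes z :: "'a::field_char_0"
  shows "cheb_sum z (N + 2) + cheb_sum z N = (2 + z) * cheb_sum z (N + 1)"
proof -
  let ?x = "of_nat (N + 1) :: 'a"
  define a where "a j x = z ^ j * central_prod j x / fact (2 * j)" for j :: nat and x :: 'a
  have step: "a (Suc j) (?x + 1) + a (Suc j) (?x - 1) = 2 * a (Suc j) ?x + z * a j ?x" for j
  proof -
    let ?c = "of_nat (2 * Suc j * (2 * j + 1)) :: 'a"
    have c: "?c \<noteq> 0" by (simp only: of_nat_eq_0_iff) simp
    have f: "fact (2 * Suc j) = ?c * (fact (2 * j) :: 'a)" by (simp add: algebra_simps)
    have "a (Suc j) (?x + 1) + a (Suc j) (?x - 1) =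
        z ^ Suc j * (central_prod (Suc j) (?x + 1) + central_prod (Suc j) (?x - 1)) / fact (2 * Suc j)"
      by (simp add: a_def add_divide_distrib distrib_left)
    also have "\<dots> = 2 * a (Suc j) ?x + z ^ Suc j * (?c * central_prod j ?x) / fact (2 * Suc j)"
      unfolding central_prod_second_difference
      by (simp only: a_def add_divide_distrib distrib_left) simp
    also have "z ^ Suc j * (?c * central_prod j ?x) / fact (2 * Suc j) = z * a j ?x"
      unfolding f a_def using c by (simp del: of_nat_mult of_nat_Suc of_nat_add)
    finally show ?thesis .
  qed
  have x: "?x + 1 = of_nat (N + 2)" "?x - 1 = of_nat N" by simp_all
  have z: "a 0 y = 1" for y by (simp add: a_def central_prod_def)
  have S: "cheb_sum z m = 1 + (\<Sum>j\<le>N + 1. a (Suc j) (of_nat m))" if "m \<le> N + 2" for m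
    using cheb_sum_extend[of m "Suc (N + 1)" z] that
    by (simp only: sum.atMost_Suc_shift a_def[symmetric] z)
  have "cheb_sum z (N + 2) + cheb_sum z N
      = 2 + (\<Sum>j\<le>N + 1. a (Suc j) (?x + 1) + a (Suc j) (?x - 1))"
    unfolding x by (simp only: S[of "N + 2"] S[of N] sum.distrib) simp
  also have "\<dots> = 2 * cheb_sum z (N + 1) + z * (\<Sum>j\<le>N + 1. a j ?x)"
    unfolding step by (simp only: S[of "N + 1"] sum.distrib sum_distrib_left distrib_left) simp
  also have "(\<Sum>j\<le>N + 1. a j ?x) = cheb_sum z (N + 1)"
    by (simp only: cheb_sum_def a_def)
  finally show ?thesis by (simp add: algebra_simps)
qed

text \<open>Chebyshev polynomials at integer points, defined by recurrence so that integrality is built in.\<close>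
fun cheb_int :: "int \<Rightarrow> nat \<Rightarrow> int" where
  "cheb_int y 0 = 1"
| "cheb_int y (Suc 0) = y"
| "cheb_int y (Suc (Suc N)) = 2 * y * cheb_int y (Suc N) - cheb_int y N"

lemma cheb_sum_eq_of_int:
  "cheb_sum (of_int (2 * y - 2)) N = (of_int (cheb_int y N) :: 'a::field_char_0)"
proof (induction N rule: induct_nat_012)
  case 0
  then show ?case by (simp add: cheb_sum_def central_prod_def)
next
  case 1
  then show ?case by (simp add: cheb_sum_def central_prod_def fact_2 diff_divide_distrib)
next
  case (ge2 N)
  then show ?case
    using cheb_sum_rec[of "of_int (2 * y - 2) :: 'a" N] by (simp add: algebra_simps)
qed

text \<open>
  The hypotheses say that \<open>u\<close> and \<open>v\<close> are the two roots of the characteristic polynomial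
  \<open>X\<^sup>2 - 2 y X + 1\<close> of the recurrence.
\<close>
lemma cheb_int_conjugate_powers:
  fixes u v :: "'a::comm_ring_1"
  assumes "u * v = 1" "u + v = 2 * of_int y"
  shows "2 * of_int (cheb_int y N) = u ^ N + v ^ N"
proof (induction N rule: induct_nat_012)
  case (ge2 N)
  have "u ^ Suc (Suc N) + v ^ Suc (Suc N) = (u + v) * (u ^ Suc N + v ^ Suc N) - u * v * (u ^ N + v ^ N)"
    by (simp add: algebra_simps)
  also have "\<dots> = 2 * of_int y * (2 * of_int (cheb_int y (Suc N))) - 2 * of_int (cheb_int y N)"
    by (simp only: assms ge2) simp
  finally show ?case by (simp add: algebra_simps)
qed (use assms in auto)

theorem theorem4:
  fixes p n :: nat
  assumes "prime p" and "p \<ge> 5" and "n = 2 ^ (p - 1)"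
  shows "prime (2 ^ p - 1 :: nat) \<longleftrightarrow>
    (\<exists>S::int.
      (of_int S :: rat) =
        (\<Sum>k\<in>{k. k \<le> n div 2 \<and> even k}.
          (- 1) ^ (k div 2) *
          ((\<Prod>l<k div 2. (of_nat n)\<^sup>2 - (4 * of_nat l)\<^sup>2) / fact k))
      \<and> (2 * int n - 1) dvd S)"
proof -
  define N :: nat where "N = 2 ^ (p - 3)"
  have n4: "n = 4 * N"
  proof -
    have "p - 1 = 2 + (p - 3)" using assms(2) by simp
    then show ?thesis by (simp only: N_def assms(3) power_add) simp
  qed
  have pn: "(2::int) ^ p = 2 * int n" using assms(2) by (cases p) (auto simp: assms(3))
  have "odd p" using assms(1,2) by (intro prime_odd_nat) simp_all
  have "(\<Sum>k\<in>{k. k \<le> n div 2 \<and> even k}.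
          (- 1) ^ (k div 2) *
          ((\<Prod>l<k div 2. (of_nat n)\<^sup>2 - (4 * of_nat l)\<^sup>2) / fact k))
      = (\<Sum>j\<le>N. (-1) ^ j * ((\<Prod>l<j. (of_nat n)\<^sup>2 - (4 * of_nat l)\<^sup>2) / fact (2 * j)) :: rat)"
    by (rule sum.reindex_bij_witness[of _ "\<lambda>j. 2 * j" "\<lambda>k. k div 2"]) (auto simp: n4)
  \<comment> \<open>Each factor is \<open>16 (N\<^sup>2 - l\<^sup>2)\<close>, so the parameter is \<open>z = -16 = 2 * (-7) - 2\<close>.\<close>
  also have "\<dots> = cheb_sum (of_int (2 * (-7) - 2)) N"
    unfolding cheb_sum_def
  proof (rule sum.cong)
    fix j
    have "(\<Prod>l<j. (of_nat n)\<^sup>2 - (4 * of_nat l)\<^sup>2)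
        = (\<Prod>l<j. 16 * ((of_nat N)\<^sup>2 - (of_nat l)\<^sup>2) :: rat)"
      by (simp add: n4 power_mult_distrib algebra_simps)
    also have "\<dots> = 16 ^ j * central_prod j (of_nat N)"
      unfolding central_prod_def prod.distrib by simp
    finally show "(-1) ^ j * ((\<Prod>l<j. (of_nat n)\<^sup>2 - (4 * of_nat l)\<^sup>2) / fact (2 * j)) =
        of_int (2 * (-7) - 2) ^ j * central_prod j (of_nat N) / (fact (2 * j) :: rat)"
      by (simp add: mult.assoc flip: power_mult_distrib)
  qed simp
  also have "\<dots> = of_int (cheb_int (-7) N)" by (rule cheb_sum_eq_of_int)
  finally have sum: "(\<Sum>k\<in>{k. k \<le> n div 2 \<and> even k}.
          (- 1) ^ (k div 2) *
          ((\<Prod>l<k div 2. (of_nat n)\<^sup>2 - (4 * of_nat l)\<^sup>2) / fact k))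
      = (of_int (cheb_int (-7) N) :: rat)" .
  have "even N" using assms(2) by (simp add: N_def)
  \<comment> \<open>\<open>\<omega>\<^sup>2 = 7 + 4 \<surd>3\<close>, so the negated squares of the unit and its conjugate have sum \<open>-14\<close>.\<close>
  have "2 * of_int (cheb_int (-7) N) = (- (unit3 ^ 2)) ^ N + (- (unit3_conj ^ 2)) ^ N"
    by (rule cheb_int_conjugate_powers) (simp_all add: power2_eq_square zsqrt3_simps of_int_zsqrt3)
  also have "(- (unit3 ^ 2)) ^ N + (- (unit3_conj ^ 2)) ^ N
      = unit3 ^ (2 * N) + unit3_conj ^ (2 * N)"
    using \<open>even N\<close> by (simp only: power_minus_even power_mult)
  also have "2 * N = 2 ^ (p - 2)"
  proof -
    have "p - 2 = Suc (p - 3)" using assms(2) by simp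
    then show ?thesis by (simp only: N_def power_Suc)
  qed
  finally have T: "2 * of_int (cheb_int (-7) N) = unit3 ^ 2 ^ (p - 2) + unit3_conj ^ 2 ^ (p - 2)" .
  have "prime (2 ^ p - 1 :: nat) \<longleftrightarrow> of_int (2 * int n - 1) dvd (2 * of_int (cheb_int (-7) N) :: zsqrt3)"
    unfolding T lucas_lehmer[OF assms(1) \<open>odd p\<close>] pn ..
  also have "\<dots> \<longleftrightarrow> (2 * int n - 1) dvd cheb_int (-7) N"
  proof -
    have "odd (2 * int n - 1)" by simp
    from odd_dvd_two_times_zsqrt3[OF this] show ?thesis
      by (simp only: of_int_dvd_of_int_zsqrt3)
  qed
  finally show ?thesis unfolding sum of_int_eq_iff by blast
qed

end
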